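(* There exist strongly left-c.e. reals $\alpha,\beta$ such that $\alpha-\beta$ is not a left-c.e. real and is not a right-c.e. real.
   Context: A real $x$ is left-c.e. if its left Dedekind cut $\{q\in\mathbb{Q}: q<x\}$ is computably enumerable, and right-c.e. if its right Dedekind cut $\{q\in\mathbb{Q}: q>x\}$ is computably enumerable. A real is strongly left-c.e. if it has a binary expansion that is the characteristic sequence of a computably enumerable set, i.e. it equals $\sum_{n\in A}2^{-n-1}$ for some computably enumerable set $A\subseteq\mathbb{N}$. *)

theory Defs
  imports Complex_Main "HOL-Library.Countable"
begin

text \<open>
  Computability is based on the partial recursive (\<open>\<mu>\<close>-recursive) functions: programs
  are generated from zero, successor and projections by composition, primitive recursion and
  unbounded minimisation. \<open>recf_eval f xs y\<close> says that \<open>f\<close> halts on the argument tuple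
  \<open>xs\<close> with output \<open>y\<close>. Arities are not part of the syntax; a program
  applied to a tuple that does not fit it simply diverges.
\<close>

datatype recf =
    Zero
  | Succ
  | Proj nat
  | Comp recf "recf list"
  | Prec recf recf
  | Mini recf

inductive recf_eval :: "recf \<Rightarrow> nat list \<Rightarrow> nat \<Rightarrow> bool" where
  zero: "recf_eval Zero xs 0"
| succ: "recf_eval Succ [x] (Suc x)"
| proj: "i < length xs \<Longrightarrow> recf_eval (Proj i) xs (xs ! i)"
| comp: "\<lbrakk>length ys = length gs; \<And>i. i < length gs \<Longrightarrow> recf_eval (gs ! i) xs (ys ! i);
          recf_eval f ys z\<rbrakk> \<Longrightarrow> recf_eval (Comp f gs) xs z"
| prec_0: "recf_eval f xs y \<Longrightarrow> recf_eval (Prec f g) (0 # xs) y"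
| prec_Suc: "\<lbrakk>recf_eval (Prec f g) (n # xs) r; recf_eval g (n # r # xs) y\<rbrakk>
          \<Longrightarrow> recf_eval (Prec f g) (Suc n # xs) y"
| mini: "\<lbrakk>recf_eval f (n # xs) 0; \<And>m. m < n \<Longrightarrow> \<exists>k. recf_eval f (m # xs) (Suc k)\<rbrakk>
          \<Longrightarrow> recf_eval (Mini f) xs n"

inductive_cases recf_eval_ZeroE: "recf_eval Zero xs y"
inductive_cases recf_eval_SuccE: "recf_eval Succ xs y"
inductive_cases recf_eval_ProjE: "recf_eval (Proj i) xs y"
inductive_cases recf_eval_CompE: "recf_eval (Comp f gs) xs y"
inductive_cases recf_eval_Prec_0E: "recf_eval (Prec f g) (0 # xs) y"
inductive_cases recf_eval_Prec_SucE: "recf_eval (Prec f g) (Suc n # xs) y"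
inductive_cases recf_eval_MiniE: "recf_eval (Mini f) xs y"

lemma recf_eval_deterministic:
  assumes "recf_eval f xs y" and "recf_eval f xs z"
  shows "y = z"
  using assms
proof (induction arbitrary: z rule: recf_eval.induct)
  case (zero xs)
  then show ?case by (auto elim!: recf_eval_ZeroE)
next
  case (succ x)
  then show ?case by (auto elim!: recf_eval_SuccE)
next
  case (proj i xs)
  then show ?case by (auto elim!: recf_eval_ProjE)
next
  case (comp ys gs xs f w)
  from comp.prems obtain ys' where len: "length ys' = length gs"
    and args: "\<forall>i<length gs. recf_eval (gs ! i) xs (ys' ! i)"
    and res: "recf_eval f ys' z"
    by (rule recf_eval_CompE) simp
  have "ys = ys'"
  proof (rule nth_equalityI)
    show "length ys = length ys'"
      using comp.hyps(1) len by simp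
    fix i assume "i < length ys"
    then have "i < length gs"
      using comp.hyps(1) by simp
    with args show "ys ! i = ys' ! i"
      by (intro comp.IH(1)) simp_all
  qed
  with res have "recf_eval f ys z"
    by simp
  then show ?case
    by (rule comp.IH(2))
next
  case (prec_0 f xs y g)
  from prec_0.prems have "recf_eval f xs z"
    by (rule recf_eval_Prec_0E)
  then show ?case
    by (rule prec_0.IH)
next
  case (prec_Suc f g n xs r y)
  from prec_Suc.prems obtain r' where r': "recf_eval (Prec f g) (n # xs) r'"
    and res: "recf_eval g (n # r' # xs) z"
    by (rule recf_eval_Prec_SucE)
  from r' have "r = r'"
    by (rule prec_Suc.IH(1))
  with res have "recf_eval g (n # r # xs) z"
    by simp
  then show ?case
    by (rule prec_Suc.IH(2))
next
  case (mini f n xs)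
  from mini.prems have z: "recf_eval f (z # xs) 0"
    and below: "\<And>m. m < z \<Longrightarrow> \<exists>k. recf_eval f (m # xs) (Suc k)"
    by (auto elim!: recf_eval_MiniE)
  have "\<not> n < z"
  proof
    assume "n < z"
    then obtain k where "recf_eval f (n # xs) (Suc k)"
      using below by blast
    then have "0 = Suc k"
      by (rule mini.IH(1))
    then show False
      by simp
  qed
  moreover have "\<not> z < n"
  proof
    assume "z < n"
    then obtain k where "\<forall>w. recf_eval f (z # xs) w \<longrightarrow> Suc k = w"
      using mini.IH(2) by blast
    with z show False
      by blast
  qed
  ultimately show ?case
    by simp
qed

definition computably_enumerable :: "nat set \<Rightarrow> bool" where
  "computably_enumerable A \<longleftrightarrow> (\<exists>f. A = {n. \<exists>y. recf_eval f [n] y})"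

text \<open>
  Sets of rationals are coded by natural numbers through the library's effective surjection
  \<^const>\<open>nat_to_rat_surj\<close>, which reads a number as a pair of integers, numerator and
  denominator (a zero denominator yields 0). A rational has infinitely many codes, and all of them are required to be
  enumerated.
\<close>

definition computably_enumerable_rat :: "rat set \<Rightarrow> bool" where
  "computably_enumerable_rat Q \<longleftrightarrow> computably_enumerable {n. nat_to_rat_surj n \<in> Q}"

definition left_ce :: "real \<Rightarrow> bool" where
  "left_ce x \<longleftrightarrow> computably_enumerable_rat {q. of_rat q < x}"

definition right_ce :: "real \<Rightarrow> bool" where
  "right_ce x \<longleftrightarrow> computably_enumerable_rat {q. of_rat q > x}"

definition strongly_left_ce :: "real \<Rightarrow> bool" where
  "strongly_left_ce x \<longleftrightarrow>
    (\<exists>A. computably_enumerable A \<and> (\<lambda>n. if n \<in> A then (1 / 2) ^ (n + 1) else 0) sums x)"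

end

theory Submission
  imports Defs
begin

text \<open>
  The two sets are defined outright from a universal computably enumerable relation, with no priority
  construction. Write \<open>x = \<alpha> - \<beta>\<close> as a series with digits \<open>-1, 0, 1\<close> in base 4, and split the positions
  into blocks so long that a block starting at \<open>b\<close> has a position for each of the \<open>4 ^ b\<close> candidate
  values of the digits before \<open>b\<close>. If the left cut of \<open>x\<close> were enumerated by some program, then some
  block would be governed by that program as follows: the position \<open>n\<close> of candidate \<open>q\<close> gets the digit
  \<open>-1\<close> precisely if the program finds \<open>q - \<epsilon> < x\<close>, with \<open>\<epsilon>\<close> half the weight of \<open>n\<close>. The
  candidates are tried in decreasing order. Those above the correct one also lie above \<open>x\<close> and leave
  the digit 0, so the correct candidate is the exact value of all digits before its position, and
  then that position's digit makes \<open>x < q - \<epsilon>\<close> if the program claims the opposite and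
  \<open>x > q - \<epsilon>\<close> otherwise. The right cut is treated by the same argument applied to \<open>1 - x\<close>.
\<close>

section \<open>Recursive functions and decidable relations\<close>

definition recfn :: "nat \<Rightarrow> (nat list \<Rightarrow> nat) \<Rightarrow> bool" where
  "recfn k h \<longleftrightarrow> (\<exists>f. \<forall>xs. length xs = k \<longrightarrow> recf_eval f xs (h xs))"

definition decidable :: "nat \<Rightarrow> (nat list \<Rightarrow> bool) \<Rightarrow> bool" where
  "decidable k P \<longleftrightarrow> recfn k (\<lambda>xs. of_bool (P xs))"

lemma recfn_cong:
  assumes "recfn k h" "\<And>xs. length xs = k \<Longrightarrow> h xs = h' xs"
  shows "recfn k h'"
  using assms unfolding recfn_def by metis

lemma recfn_nth: "i < k \<Longrightarrow> recfn k (\<lambda>xs. xs ! i)"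
  unfolding recfn_def by (metis proj)

lemma recfn_hd: "recfn (Suc k) (\<lambda>xs. hd xs)"
  by (rule recfn_cong[OF recfn_nth[of 0]]) (auto simp: length_Suc_conv)

lemma recfn_comp:
  assumes "recfn l h" "l = length hs" "\<And>g. g \<in> set hs \<Longrightarrow> recfn k g"
  shows "recfn k (\<lambda>xs. h (map (\<lambda>g. g xs) hs))"
proof -
  obtain f where f: "\<And>xs. length xs = length hs \<Longrightarrow> recf_eval f xs (h xs)"
    using assms(1,2) unfolding recfn_def by blast
  from assms(3) obtain p where
    p: "\<And>g xs. g \<in> set hs \<Longrightarrow> length xs = k \<Longrightarrow> recf_eval (p g) xs (g xs)"
    unfolding recfn_def by metis
  have "recf_eval (Comp f (map p hs)) xs (h (map (\<lambda>g. g xs) hs))" if "length xs = k" for xs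
    by (rule comp[where ys = "map (\<lambda>g. g xs) hs"]) (auto intro: f p that)
  then show ?thesis
    unfolding recfn_def by blast
qed

text \<open>A bounded quantifier prepends its variable to the argument list and
  \<open>recfn_rec_nat\<close> prepends two, so expressions in the outer variables have to be moved
  past them.\<close>

lemma recfn_tl:
  assumes "recfn k h"
  shows "recfn (Suc k) (\<lambda>xs. h (tl xs))"
proof -
  let ?hs = "map (\<lambda>i (xs :: nat list). xs ! i) [1..<Suc k]"
  have "recfn (Suc k) (\<lambda>xs. h (map (\<lambda>g. g xs) ?hs))"
    by (rule recfn_comp[OF assms]) (auto intro: recfn_nth)
  moreover have "map (\<lambda>g. g xs) ?hs = tl xs" if "length xs = Suc k" for xs :: "nat list"
    using that by (intro nth_equalityI) (auto simp: nth_tl simp del: upt_Suc)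
  ultimately show ?thesis
    by (elim recfn_cong) simp
qed

lemma recfn_Suc:
  assumes "recfn k a"
  shows "recfn k (\<lambda>xs. Suc (a xs))"
proof -
  have "recfn 1 (\<lambda>xs. Suc (xs ! 0))"
    unfolding recfn_def
    by (rule exI[of _ Succ]) (auto simp: length_Suc_conv intro: succ)
  from recfn_comp[OF this, of "[a]"] assms show ?thesis
    by simp
qed

lemma recfn_const: "recfn k (\<lambda>xs. c)"
proof (induction c)
  case 0
  show ?case
    unfolding recfn_def by (metis zero)
qed (rule recfn_Suc)

lemma recfn_rec_nat:
  assumes "recfn k a" "recfn k c"
    and "recfn (Suc (Suc k)) (\<lambda>ys. b (hd ys) (hd (tl ys)) (tl (tl ys)))"
  shows "recfn k (\<lambda>xs. rec_nat (a xs) (\<lambda>n r. b n r xs) (c xs))"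
proof -
  obtain f g where f: "\<And>xs. length xs = k \<Longrightarrow> recf_eval f xs (a xs)"
    and g: "\<And>n r xs. length xs = k \<Longrightarrow> recf_eval g (n # r # xs) (b n r xs)"
  proof -
    fix thesis
    assume that: "\<And>f g. (\<And>xs. length xs = k \<Longrightarrow> recf_eval f xs (a xs)) \<Longrightarrow>
      (\<And>n r xs. length xs = k \<Longrightarrow> recf_eval g (n # r # xs) (b n r xs)) \<Longrightarrow> thesis"
    obtain f where "\<forall>xs. length xs = k \<longrightarrow> recf_eval f xs (a xs)"
      using assms(1) unfolding recfn_def by blast
    moreover obtain g where g: "\<forall>ys. length ys = Suc (Suc k) \<longrightarrow>
        recf_eval g ys (b (hd ys) (hd (tl ys)) (tl (tl ys)))"
      using assms(3) unfolding recfn_def by blast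
    moreover have "recf_eval g (n # r # xs) (b n r xs)" if "length xs = k" for n r xs
      using g[rule_format, of "n # r # xs"] that by simp
    ultimately show thesis
      using that by blast
  qed
  have "recf_eval (Prec f g) (n # xs) (rec_nat (a xs) (\<lambda>n r. b n r xs) n)"
    if "length xs = k" for n xs
    by (induction n) (auto intro: prec_0 prec_Suc f g that)
  then have "recfn (Suc k) (\<lambda>ys. rec_nat (a (tl ys)) (\<lambda>n r. b n r (tl ys)) (hd ys))"
    unfolding recfn_def by (intro exI[of _ "Prec f g"]) (auto simp: length_Suc_conv)
  \<comment> \<open>\<open>Prec\<close> recurses on its first argument; composition with
    \<open>c\<close> and the projections supplies the bound there and keeps \<open>xs\<close> as
    parameters.\<close>
  then have "recfn k (\<lambda>xs. (\<lambda>ys. rec_nat (a (tl ys)) (\<lambda>n r. b n r (tl ys)) (hd ys))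
      (map (\<lambda>g. g xs) (c # map (\<lambda>i xs. xs ! i) [0..<k])))"
    by (rule recfn_comp) (auto intro: recfn_nth assms(2))
  moreover have "map (\<lambda>g. g xs) (map (\<lambda>i xs. xs ! i) [0..<k]) = xs"
    if "length xs = k" for xs :: "nat list"
    using that by (auto simp: comp_def map_nth)
  ultimately show ?thesis
    by (elim recfn_cong) (simp add: comp_def)
qed

lemmas recfn_basic = recfn_const recfn_Suc recfn_hd recfn_nth recfn_tl

lemma recfn_add:
  assumes "recfn k a" "recfn k c"
  shows "recfn k (\<lambda>xs. a xs + c xs)"
proof -
  have "rec_nat m (\<lambda>_ r. Suc r) n = m + n" for m n :: nat
    by (induction n) auto
  moreover have "recfn k (\<lambda>xs. rec_nat (a xs) (\<lambda>_ r. Suc r) (c xs))"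
    by (intro recfn_rec_nat assms recfn_basic)
  ultimately show ?thesis by simp
qed

lemma recfn_mult:
  assumes "recfn k a" "recfn k c"
  shows "recfn k (\<lambda>xs. a xs * c xs)"
proof -
  have "rec_nat 0 (\<lambda>_ r. r + m) n = m * n" for m n :: nat
    by (induction n) auto
  moreover have "recfn k (\<lambda>xs. rec_nat 0 (\<lambda>_ r. r + a xs) (c xs))"
    by (intro recfn_rec_nat recfn_add assms recfn_basic)
  ultimately show ?thesis by simp
qed

lemma recfn_power:
  assumes "recfn k a" "recfn k c"
  shows "recfn k (\<lambda>xs. a xs ^ c xs)"
proof -
  have "rec_nat 1 (\<lambda>_ r. r * m) n = m ^ n" for m n :: nat
    by (induction n) auto
  moreover have "recfn k (\<lambda>xs. rec_nat 1 (\<lambda>_ r. r * a xs) (c xs))"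
    by (intro recfn_rec_nat recfn_mult assms recfn_basic)
  ultimately show ?thesis by simp
qed

lemma recfn_diff:
  assumes "recfn k a" "recfn k c"
  shows "recfn k (\<lambda>xs. a xs - c xs)"
proof -
  have pred: "rec_nat 0 (\<lambda>n _. n) n = n - 1" for n :: nat
    by (cases n) auto
  have "rec_nat m (\<lambda>_ r. rec_nat 0 (\<lambda>n _. n) r) n = m - n" for m n :: nat
    by (induction n) (auto simp: pred)
  moreover have "recfn k (\<lambda>xs. rec_nat (a xs) (\<lambda>_ r. rec_nat 0 (\<lambda>n _. n) r) (c xs))"
    by (intro recfn_rec_nat assms recfn_basic)
  ultimately show ?thesis by simp
qed

lemma recfn_prod_encode:
  assumes "recfn k a" "recfn k c"
  shows "recfn k (\<lambda>xs. prod_encode (a xs, c xs))"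
proof -
  have "rec_nat 0 (\<lambda>n r. r + Suc n) n = triangle n" for n :: nat
    by (induction n) auto
  moreover have "recfn k (\<lambda>xs. rec_nat 0 (\<lambda>n r. r + Suc n) (a xs + c xs) + a xs)"
    by (intro recfn_rec_nat recfn_add assms recfn_basic)
  ultimately show ?thesis by (simp add: prod_encode_def)
qed

lemmas recfn_intros =
  recfn_const recfn_Suc recfn_add recfn_mult recfn_power recfn_diff recfn_prod_encode
  recfn_hd recfn_nth recfn_tl

section \<open>Decidable relations, bounded quantifiers and unbounded search\<close>

lemma decidable_const: "decidable k (\<lambda>xs. b)"
  unfolding decidable_def by (rule recfn_const)

lemma decidable_le:
  assumes "recfn k a" "recfn k c"
  shows "decidable k (\<lambda>xs. a xs \<le> c xs)"
proof -
  \<comment> \<open>Truncated subtraction: the value is 1 if \<open>a xs <= c xs\<close> and 0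
    otherwise.\<close>
  have "recfn k (\<lambda>xs. 1 - (a xs - c xs))"
    by (intro recfn_intros assms)
  then show ?thesis
    unfolding decidable_def by (rule recfn_cong) (auto simp: of_bool_def)
qed

lemma decidable_not:
  assumes "decidable k P"
  shows "decidable k (\<lambda>xs. \<not> P xs)"
proof -
  have "recfn k (\<lambda>xs. 1 - of_bool (P xs))"
    using assms unfolding decidable_def by (intro recfn_intros)
  then show ?thesis
    unfolding decidable_def by (rule recfn_cong) auto
qed

lemma decidable_conj:
  assumes "decidable k P" "decidable k Q"
  shows "decidable k (\<lambda>xs. P xs \<and> Q xs)"
proof -
  have "recfn k (\<lambda>xs. of_bool (P xs) * of_bool (Q xs))"
    using assms unfolding decidable_def by (rule recfn_mult)
  then show ?thesis
    unfolding decidable_def by (rule recfn_cong) auto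
qed

lemma decidable_disj:
  assumes "decidable k P" "decidable k Q"
  shows "decidable k (\<lambda>xs. P xs \<or> Q xs)"
  using decidable_not[OF decidable_conj[OF assms[THEN decidable_not]]] by simp

lemma decidable_imp:
  assumes "decidable k P" "decidable k Q"
  shows "decidable k (\<lambda>xs. P xs \<longrightarrow> Q xs)"
  using decidable_disj[OF decidable_not[OF assms(1)] assms(2)] by simp

lemma decidable_less:
  assumes "recfn k a" "recfn k c"
  shows "decidable k (\<lambda>xs. a xs < c xs)"
  using decidable_not[OF decidable_le[OF assms(2,1)]] by (simp add: not_le)

lemma decidable_eq:
  assumes "recfn k a" "recfn k c"
  shows "decidable k (\<lambda>xs. a xs = c xs)"
  using decidable_conj[OF decidable_le[OF assms] decidable_le[OF assms(2,1)]]
  by (simp add: eq_iff)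

lemma decidable_ex_less:
  assumes "recfn k c" "decidable (Suc k) (\<lambda>ys. P (hd ys) (tl ys))"
  shows "decidable k (\<lambda>xs. \<exists>m<c xs. P m xs)"
proof -
  \<comment> \<open>\<open>1 - (1 - s)\<close> is the sign of \<open>s\<close>, so the accumulator
    stays in {0, 1}.\<close>
  have *: "rec_nat 0 (\<lambda>m r. 1 - (1 - (r + of_bool (Q m)))) n = (of_bool (\<exists>m<n. Q m) :: nat)"
    for Q and n :: nat
    by (induction n) (auto simp: less_Suc_eq)
  have "recfn (Suc k) (\<lambda>ys. of_bool (P (hd ys) (tl ys)))"
    using assms(2) by (simp add: decidable_def)
  \<comment> \<open>The recursion step also receives the accumulator, at index 1; the projections
    from index 2 on hide it from \<open>P\<close>.\<close>
  then have "recfn (Suc (Suc k))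
    (\<lambda>zs. (\<lambda>ys. of_bool (P (hd ys) (tl ys)))
       (map (\<lambda>g. g zs) (hd # map (\<lambda>i ys. ys ! i) [2..<Suc (Suc k)])))"
    by (rule recfn_comp) (auto intro: recfn_hd recfn_nth)
  moreover have "map (\<lambda>g. g zs) (map (\<lambda>i ys. ys ! i) [2..<Suc (Suc k)]) = tl (tl zs)"
    if "length zs = Suc (Suc k)" for zs :: "nat list"
    using that by (intro nth_equalityI) (auto simp: nth_tl simp del: upt_Suc)
  ultimately have "recfn (Suc (Suc k)) (\<lambda>zs. of_bool (P (hd zs) (tl (tl zs))))"
    by (elim recfn_cong) (simp del: upt_Suc add: comp_def)
  then have "recfn k (\<lambda>xs. rec_nat 0 (\<lambda>m r. 1 - (1 - (r + of_bool (P m xs)))) (c xs))"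
    by (intro recfn_rec_nat recfn_intros assms(1))
  then show ?thesis
    unfolding decidable_def * .
qed

lemma decidable_all_less:
  assumes "recfn k c" "decidable (Suc k) (\<lambda>ys. P (hd ys) (tl ys))"
  shows "decidable k (\<lambda>xs. \<forall>m<c xs. P m xs)"
  using decidable_not[OF decidable_ex_less[OF assms(1) decidable_not[OF assms(2)]]] by simp

text \<open>Bit \<open>t\<close> of \<open>d\<close> is the parity of \<open>d div 2 ^ t\<close>.
  Writing out the division with remainder leaves bounded quantifiers over sums, products and powers,
  to which the closure rules apply.\<close>

lemma mem_set_decode_iff:
  "t \<in> set_decode d \<longleftrightarrow> (\<exists>q<Suc d. \<exists>r<2 ^ t. d = (2 * q + 1) * 2 ^ t + r)"
proof
  assume "t \<in> set_decode d"
  then obtain q where q: "d div 2 ^ t = 2 * q + 1"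
    by (auto simp: set_decode_def elim: oddE)
  then have "d = (2 * q + 1) * 2 ^ t + d mod 2 ^ t"
    by (metis div_mult_mod_eq)
  moreover have "q < Suc d"
    using div_le_dividend[of d "2 ^ t"] q by linarith
  moreover have "d mod 2 ^ t < 2 ^ t"
    by simp
  ultimately show "\<exists>q<Suc d. \<exists>r<2 ^ t. d = (2 * q + 1) * 2 ^ t + r"
    by blast
next
  assume "\<exists>q<Suc d. \<exists>r<2 ^ t. d = (2 * q + 1) * 2 ^ t + r"
  then obtain q r where qr: "r < 2 ^ t" "d = r + (2 * q + 1) * 2 ^ t"
    by (auto simp: add.commute)
  have "d div 2 ^ t = 2 * q + 1"
    unfolding qr(2) by (subst div_mult_self1) (use qr(1) in simp_all)
  then show "t \<in> set_decode d"
    by (simp add: set_decode_def)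
qed

lemma decidable_mem_set_decode:
  assumes "recfn k a" "recfn k c"
  shows "decidable k (\<lambda>xs. a xs \<in> set_decode (c xs))"
  unfolding mem_set_decode_iff
  by (intro decidable_ex_less decidable_eq recfn_intros assms recfn_tl[OF recfn_tl[OF assms(1)]]
      recfn_tl[OF recfn_tl[OF assms(2)]])

lemmas decidable_intros = decidable_const decidable_le decidable_less decidable_eq
  decidable_conj decidable_disj decidable_imp decidable_ex_less decidable_all_less
  decidable_mem_set_decode recfn_intros

text \<open>\<open>Mini\<close> looks for the least zero, so it is applied to the characteristic
  function of the negation. That function is total, hence the search halts exactly if a witness
  exists.\<close>

lemma computably_enumerable_ex:
  assumes "decidable (Suc (Suc 0)) (\<lambda>ys. P (hd ys) (hd (tl ys)))"
  shows "computably_enumerable {n. \<exists>d. P d n}"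
proof -
  from decidable_not[OF assms] obtain f where
    *: "\<And>ys. length ys = Suc (Suc 0) \<Longrightarrow> recf_eval f ys (of_bool (\<not> P (hd ys) (hd (tl ys))))"
    unfolding decidable_def recfn_def by blast
  have f: "recf_eval f [d, n] (of_bool (\<not> P d n))" for d n
    using *[of "[d, n]"] by simp
  have "(\<exists>d. P d n) \<longleftrightarrow> (\<exists>y. recf_eval (Mini f) [n] y)" for n
  proof
    assume "\<exists>d. P d n"
    then obtain y where y: "P y n" "\<And>m. m < y \<Longrightarrow> \<not> P m n"
      using exists_least_iff[of "\<lambda>d. P d n"] by blast
    have "recf_eval (Mini f) [n] y"
    proof (rule mini)
      show "recf_eval f [y, n] 0"
        using f[of y n] y(1) by simp
      show "\<exists>k. recf_eval f [m, n] (Suc k)" if "m < y" for m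
        using f[of m n] y(2)[OF that] by auto
    qed
    then show "\<exists>y. recf_eval (Mini f) [n] y" ..
  next
    assume "\<exists>y. recf_eval (Mini f) [n] y"
    then obtain y where "recf_eval f [y, n] 0"
      by (auto elim: recf_eval_MiniE)
    from recf_eval_deterministic[OF this f] show "\<exists>d. P d n"
      by (auto split: if_splits simp: of_bool_def)
  qed
  then show ?thesis
    unfolding computably_enumerable_def by blast
qed


section \<open>A universal computably enumerable relation\<close>

text \<open>The tags 6 and 7, which no program uses, are for two auxiliary kinds of computation: applying
  a list of programs to the same arguments, and checking that \<open>f (m # xs) > 0\<close> for all \<open>m < n\<close>.\<close>

fun encode_recf :: "recf \<Rightarrow> nat" where
  "encode_recf Zero = prod_encode (0, 0)"
| "encode_recf Succ = prod_encode (1, 0)"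
| "encode_recf (Proj i) = prod_encode (2, i)"
| "encode_recf (Comp f gs) =
    prod_encode (3, prod_encode (encode_recf f, list_encode (map encode_recf gs)))"
| "encode_recf (Prec f g) = prod_encode (4, prod_encode (encode_recf f, encode_recf g))"
| "encode_recf (Mini f) = prod_encode (5, encode_recf f)"

text \<open>The \<open>Cons\<close> case of \<open>list_encode\<close>, which codes the empty list
  by 0; the rules can thus be stated on codes.\<close>

abbreviation cons_code :: "nat \<Rightarrow> nat \<Rightarrow> nat" where
  "cons_code x l \<equiv> Suc (prod_encode (x, l))"

abbreviation eval_code :: "nat \<Rightarrow> nat \<Rightarrow> nat \<Rightarrow> nat" where
  "eval_code p l y \<equiv> prod_encode (p, prod_encode (l, y))"

text \<open>\<open>rule_instance D t f g l y z n\<close> says that \<open>t\<close> follows from \<open>D\<close> by one evaluation rule,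
  the remaining arguments being the values of the rule's variables.\<close>

definition rule_instance ::
    "nat set \<Rightarrow> nat \<Rightarrow> nat \<Rightarrow> nat \<Rightarrow> nat \<Rightarrow> nat \<Rightarrow> nat \<Rightarrow> nat \<Rightarrow> bool" where
  "rule_instance D t f g l y z n \<longleftrightarrow>
     t = eval_code (prod_encode (0, 0)) l 0 \<or>
     t = eval_code (prod_encode (1, 0)) (cons_code n 0) (Suc n) \<or>
     t = eval_code (prod_encode (2, 0)) (cons_code y l) y \<or>
     (t = eval_code (prod_encode (2, Suc n)) (cons_code z l) y \<and>
       eval_code (prod_encode (2, n)) l y \<in> D) \<or>
     (t = eval_code (prod_encode (3, prod_encode (f, g))) l y \<and>
       eval_code (prod_encode (6, g)) l z \<in> D \<and> eval_code f z y \<in> D) \<or>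
     t = eval_code (prod_encode (6, 0)) l 0 \<or>
     (t = eval_code (prod_encode (6, cons_code f g)) l (cons_code y z) \<and>
       eval_code f l y \<in> D \<and> eval_code (prod_encode (6, g)) l z \<in> D) \<or>
     (t = eval_code (prod_encode (4, prod_encode (f, g))) (cons_code 0 l) y \<and>
       eval_code f l y \<in> D) \<or>
     (t = eval_code (prod_encode (4, prod_encode (f, g))) (cons_code (Suc n) l) y \<and>
       eval_code (prod_encode (4, prod_encode (f, g))) (cons_code n l) z \<in> D \<and>
       eval_code g (cons_code n (cons_code z l)) y \<in> D) \<or>
     (t = eval_code (prod_encode (5, f)) l n \<and>
       eval_code (prod_encode (7, f)) (cons_code n l) 0 \<in> D \<and>
       eval_code f (cons_code n l) 0 \<in> D) \<or>
     t = eval_code (prod_encode (7, f)) (cons_code 0 l) 0 \<or>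
     (t = eval_code (prod_encode (7, f)) (cons_code (Suc n) l) 0 \<and>
       eval_code (prod_encode (7, f)) (cons_code n l) 0 \<in> D \<and>
       eval_code f (cons_code n l) (Suc z) \<in> D)"

text \<open>A derivation is a set rather than a sequence. Circular justifications cannot arise,
  since every rule passes to subprograms, a shorter list or a smaller counter.\<close>

definition derivation :: "nat \<Rightarrow> nat set \<Rightarrow> bool" where
  "derivation N D \<longleftrightarrow> (\<forall>t\<in>D.
     \<exists>f<N. \<exists>g<N. \<exists>l<N. \<exists>y<N. \<exists>z<N. \<exists>n<N. rule_instance D t f g l y z n)"

definition derivable :: "nat \<Rightarrow> bool" where
  "derivable t \<longleftrightarrow> (\<exists>N D. finite D \<and> derivation N D \<and> t \<in> D)"

text \<open>Every occurrence of \<open>D\<close> in the rules is positive.\<close>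

lemma rule_instance_mono:
  assumes "rule_instance D t f g l y z n" "D \<subseteq> D'"
  shows "rule_instance D' t f g l y z n"
proof (rule mp[OF _ assms(1)])
  show "rule_instance D t f g l y z n \<longrightarrow> rule_instance D' t f g l y z n"
    unfolding rule_instance_def by (intro imp_refl disj_mono conj_mono in_mono assms(2))
qed

text \<open>Derivations of the finitely many premises are united under a common bound, and
  \<open>t\<close> is added. In the uses below, \<open>S\<close> is the set of premises, and
  variables absent from the rule are set to 0.\<close>

lemma derivable_rule_instance:
  assumes t: "rule_instance S t f g l y z n" and "finite S" and "\<forall>s\<in>S. derivable s"
  shows "derivable t"
proof -
  obtain M E where E: "\<And>s. s \<in> S \<Longrightarrow> finite (E s) \<and> derivation (M s) (E s) \<and> s \<in> E s"
    using assms(3) unfolding derivable_def by metis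
  let ?N = "Suc (sum M S + f + g + l + y + z + n)" and ?D = "insert t (\<Union>s\<in>S. E s)"
  have "derivation ?N ?D"
    unfolding derivation_def
  proof
    fix u assume "u \<in> ?D"
    then consider "u = t" | s where "s \<in> S" "u \<in> E s"
      by blast
    then show "\<exists>f<?N. \<exists>g<?N. \<exists>l<?N. \<exists>y<?N. \<exists>z<?N. \<exists>n<?N. rule_instance ?D u f g l y z n"
    proof cases
      case 1
      have "S \<subseteq> ?D"
        using E by blast
      with t have "rule_instance ?D u f g l y z n"
        unfolding 1 by (rule rule_instance_mono)
      moreover have "f < ?N" "g < ?N" "l < ?N" "y < ?N" "z < ?N" "n < ?N"
        by auto
      ultimately show ?thesis
        by blast
    next
      case 2
      then have "M s \<le> sum M S"
        using \<open>finite S\<close> by (simp add: member_le_sum)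
      then have le: "i < ?N" if "i < M s" for i
        using that by linarith
      obtain f' g' l' y' z' n' where
        less: "f' < M s" "g' < M s" "l' < M s" "y' < M s" "z' < M s" "n' < M s" and
        "rule_instance (E s) u f' g' l' y' z' n'"
        using E[OF 2(1)] 2(2) unfolding derivation_def by blast
      moreover have "E s \<subseteq> ?D"
        using 2 by blast
      ultimately have "rule_instance ?D u f' g' l' y' z' n'"
        by (simp add: rule_instance_mono)
      with less[THEN le] show ?thesis
        by blast
    qed
  qed
  moreover have "finite ?D"
    using \<open>finite S\<close> E by blast
  ultimately show ?thesis
    unfolding derivable_def by blast
qed

section \<open>Every evaluation has a derivation\<close>

lemma derivable_Zero: "derivable (eval_code (prod_encode (0, 0)) l 0)"
  by (rule derivable_rule_instance[of "{}" _ 0 0 l 0 0 0]) (simp_all add: rule_instance_def)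

lemma derivable_Succ: "derivable (eval_code (prod_encode (1, 0)) (cons_code n 0) (Suc n))"
  by (rule derivable_rule_instance[of "{}" _ 0 0 0 0 0 n]) (simp_all add: rule_instance_def)

lemma derivable_Proj:
  "i < length xs \<Longrightarrow> derivable (eval_code (prod_encode (2, i)) (list_encode xs) (xs ! i))"
proof (induction xs arbitrary: i)
  case (Cons x xs)
  show ?case
  proof (cases i)
    case 0
    show ?thesis
      unfolding 0 by (rule derivable_rule_instance[of "{}" _ 0 0 "list_encode xs" x 0 0])
        (simp_all add: rule_instance_def)
  next
    case (Suc j)
    show ?thesis
      unfolding Suc
      by (rule derivable_rule_instance[of "{eval_code (prod_encode (2, j)) (list_encode xs) (xs ! j)}"
            _ 0 0 "list_encode xs" "xs ! j" x j])
        (use Cons Suc in \<open>simp_all add: rule_instance_def\<close>)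
  qed
qed simp

lemma derivable_Comp:
  assumes "derivable (eval_code (prod_encode (6, g)) l z)" "derivable (eval_code f z y)"
  shows "derivable (eval_code (prod_encode (3, prod_encode (f, g))) l y)"
  by (rule derivable_rule_instance[of
        "{eval_code (prod_encode (6, g)) l z, eval_code f z y}" _ f g l y z 0])
    (simp_all add: rule_instance_def assms)

lemma derivable_list:
  assumes "length ys = length gs"
    and "\<And>i. i < length gs \<Longrightarrow> derivable (eval_code (gs ! i) l (ys ! i))"
  shows "derivable (eval_code (prod_encode (6, list_encode gs)) l (list_encode ys))"
  using assms
proof (induction ys gs rule: list_induct2)
  case Nil
  show ?case
    by (rule derivable_rule_instance[of "{}" _ 0 0 l 0 0 0]) (simp_all add: rule_instance_def)
next
  case (Cons y ys g gs)
  have "derivable (eval_code g l y)"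
    using Cons.prems[of 0] by simp
  moreover have "derivable (eval_code (prod_encode (6, list_encode gs)) l (list_encode ys))"
    using Cons.prems[of "Suc i" for i] by (intro Cons.IH) simp
  ultimately show ?case
    by (intro derivable_rule_instance[of "{eval_code g l y,
          eval_code (prod_encode (6, list_encode gs)) l (list_encode ys)}"
          _ g "list_encode gs" l y "list_encode ys" 0])
      (simp_all add: rule_instance_def)
qed

lemma derivable_Prec_0:
  assumes "derivable (eval_code f l y)"
  shows "derivable (eval_code (prod_encode (4, prod_encode (f, g))) (cons_code 0 l) y)"
  by (rule derivable_rule_instance[of "{eval_code f l y}" _ f g l y 0 0])
    (simp_all add: rule_instance_def assms)

lemma derivable_Prec_Suc:
  assumes "derivable (eval_code (prod_encode (4, prod_encode (f, g))) (cons_code n l) z)"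
    and "derivable (eval_code g (cons_code n (cons_code z l)) y)"
  shows "derivable (eval_code (prod_encode (4, prod_encode (f, g))) (cons_code (Suc n) l) y)"
  by (rule derivable_rule_instance[of
        "{eval_code (prod_encode (4, prod_encode (f, g))) (cons_code n l) z,
          eval_code g (cons_code n (cons_code z l)) y}" _ f g l y z n])
    (simp_all add: rule_instance_def assms)

lemma derivable_all_pos:
  assumes "\<And>m. m < n \<Longrightarrow> \<exists>k. derivable (eval_code f (cons_code m l) (Suc k))"
  shows "derivable (eval_code (prod_encode (7, f)) (cons_code n l) 0)"
  using assms
proof (induction n)
  case 0
  show ?case
    by (rule derivable_rule_instance[of "{}" _ f 0 l 0 0 0]) (simp_all add: rule_instance_def)
next
  case (Suc n)
  obtain k where "derivable (eval_code f (cons_code n l) (Suc k))"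
    using Suc.prems by blast
  moreover have "derivable (eval_code (prod_encode (7, f)) (cons_code n l) 0)"
    using Suc by simp
  ultimately show ?case
    by (intro derivable_rule_instance[of "{eval_code f (cons_code n l) (Suc k),
          eval_code (prod_encode (7, f)) (cons_code n l) 0}" _ f 0 l 0 k n])
      (simp_all add: rule_instance_def)
qed

lemma derivable_Mini:
  assumes "derivable (eval_code f (cons_code n l) 0)"
    and "\<And>m. m < n \<Longrightarrow> \<exists>k. derivable (eval_code f (cons_code m l) (Suc k))"
  shows "derivable (eval_code (prod_encode (5, f)) l n)"
  by (rule derivable_rule_instance[of "{eval_code f (cons_code n l) 0,
        eval_code (prod_encode (7, f)) (cons_code n l) 0}" _ f 0 l 0 0 n])
    (simp_all add: rule_instance_def assms derivable_all_pos)

lemma recf_eval_imp_derivable: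
  "recf_eval p xs v \<Longrightarrow> derivable (eval_code (encode_recf p) (list_encode xs) v)"
proof (induction rule: recf_eval.induct)
  case (zero xs)
  show ?case
    using derivable_Zero by simp
next
  case (succ x)
  show ?case
    using derivable_Succ by simp
next
  case (proj i xs)
  then show ?case
    using derivable_Proj by simp
next
  case (comp ys gs xs f z)
  then have "derivable (eval_code (prod_encode (6, list_encode (map encode_recf gs)))
      (list_encode xs) (list_encode ys))"
    by (intro derivable_list) auto
  then show ?case
    using comp by (auto intro: derivable_Comp)
next
  case (prec_0 f xs y g)
  then show ?case
    by (auto intro: derivable_Prec_0)
next
  case (prec_Suc f g n xs r y)
  then show ?case
    by (auto intro: derivable_Prec_Suc)
next
  case (mini f n xs)
  have "derivable (eval_code (prod_encode (5, encode_recf f)) (list_encode xs) n)"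
    by (rule derivable_Mini) (use mini in auto)
  then show ?case
    by simp
qed

section \<open>Derivations yield only correct evaluations\<close>

lemma list_encode_eq_Suc_iff:
  "list_encode xs = cons_code x l \<longleftrightarrow> (\<exists>ys. xs = x # ys \<and> list_encode ys = l)"
  by (cases xs) (auto simp: prod_encode_eq)

lemma list_encode_eq_0_iff: "list_encode xs = 0 \<longleftrightarrow> xs = []"
  by (cases xs) auto

text \<open>Induction on the program, with inner inductions on the projection index, the list of
  subprograms, the recursion argument and the search bound. This takes the place of a rank on the
  elements of \<open>D\<close>.\<close>

lemma derivation_imp_recf_eval:
  assumes D: "derivation N D"
  shows "eval_code (encode_recf p) (list_encode xs) v \<in> D \<Longrightarrow> recf_eval p xs v"
proof -
  \<comment> \<open>The tags being distinct, these facts leave only the rules for the outermost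
    constructor.\<close>
  note simps = rule_instance_def prod_encode_eq list_encode_eq_Suc_iff list_encode_eq_0_iff
  have step: "\<exists>f g l y z n. rule_instance D t f g l y z n" if "t \<in> D" for t
    using D that unfolding derivation_def by blast
  show "eval_code (encode_recf p) (list_encode xs) v \<in> D \<Longrightarrow> recf_eval p xs v"
  proof (induction p arbitrary: xs v)
    case Zero
    from step[OF Zero] show ?case
      by (auto simp: simps intro: recf_eval.zero)
  next
    case Succ
    from step[OF Succ] show ?case
      by (auto simp: simps intro: recf_eval.succ)
  next
    case (Proj i)
    have "i < length xs \<and> v = xs ! i"
      if "eval_code (prod_encode (2, i)) (list_encode xs) v \<in> D"
      using that
    proof (induction i arbitrary: xs)
      case 0
      from step[OF 0] show ?case
        by (auto simp: simps)
    next
      case (Suc i)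
      from step[OF Suc.prems] obtain x ys where "xs = x # ys"
        "eval_code (prod_encode (2, i)) (list_encode ys) v \<in> D"
        by (auto simp: simps)
      with Suc.IH show ?case
        by auto
    qed
    with Proj show ?case
      by (auto intro: recf_eval.proj)
  next
    case (Comp f gs)
    have list: "\<exists>ys. z = list_encode ys \<and> length ys = length hs \<and>
        (\<forall>i<length hs. recf_eval (hs ! i) xs (ys ! i))"
      if "eval_code (prod_encode (6, list_encode (map encode_recf hs))) (list_encode xs) z \<in> D"
        "set hs \<subseteq> set gs" for hs z
      using that
    proof (induction hs arbitrary: z)
      case Nil
      from step[OF Nil(1)] show ?case
        by (auto simp: simps)
    next
      case (Cons h hs)
      from step[OF Cons.prems(1)] obtain y z' where
        z: "z = cons_code y z'" "eval_code (encode_recf h) (list_encode xs) y \<in> D"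
        "eval_code (prod_encode (6, list_encode (map encode_recf hs))) (list_encode xs) z' \<in> D"
        by (auto simp: simps)
      then obtain ys where "z' = list_encode ys" "length ys = length hs"
        "\<forall>i<length hs. recf_eval (hs ! i) xs (ys ! i)"
        using Cons by auto
      moreover have "recf_eval h xs y"
        using Comp.IH(2) Cons.prems(2) z(2) by auto
      ultimately show ?case
        using z(1) by (intro exI[of _ "y # ys"]) (auto simp: less_Suc_eq_0_disj)
    qed
    from step[OF Comp.prems] obtain z where
      z: "eval_code (prod_encode (6, list_encode (map encode_recf gs))) (list_encode xs) z \<in> D"
        "eval_code (encode_recf f) z v \<in> D"
      by (auto simp: simps)
    from list[OF z(1)] obtain ys where "z = list_encode ys" "length ys = length gs"
      "\<forall>i<length gs. recf_eval (gs ! i) xs (ys ! i)"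
      by auto
    then show ?case
      using z(2) Comp.IH(1) by (auto intro: recf_eval.comp)
  next
    case (Prec f g)
    from step[OF Prec.prems] obtain n ys where xs: "xs = n # ys"
      by (auto simp: simps)
    have "recf_eval (Prec f g) (n # ys) v"
      using Prec.prems unfolding xs
    proof (induction n arbitrary: v)
      case 0
      from step[OF 0] have "eval_code (encode_recf f) (list_encode ys) v \<in> D"
        by (auto simp: simps)
      with Prec.IH(1) show ?case
        by (auto intro: recf_eval.prec_0)
    next
      case (Suc n)
      from step[OF Suc.prems] obtain z where
        "eval_code (encode_recf (Prec f g)) (list_encode (n # ys)) z \<in> D"
        "eval_code (encode_recf g) (list_encode (n # z # ys)) v \<in> D"
        by (auto simp: simps)
      then show ?case
        by (intro recf_eval.prec_Suc[of f g n ys z] Suc.IH Prec.IH(2))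
    qed
    then show ?case
      unfolding xs .
  next
    case (Mini f)
    have pos: "\<exists>k. recf_eval f (m # xs) (Suc k)"
      if "eval_code (prod_encode (7, encode_recf f)) (cons_code n (list_encode xs)) 0 \<in> D" "m < n"
      for m n
      using that
    proof (induction n)
      case (Suc n)
      from step[OF Suc.prems(1)] obtain k where
        "eval_code (prod_encode (7, encode_recf f)) (cons_code n (list_encode xs)) 0 \<in> D"
        "eval_code (encode_recf f) (list_encode (n # xs)) (Suc k) \<in> D"
        by (auto simp: simps)
      moreover from this(2) have "recf_eval f (n # xs) (Suc k)"
        by (rule Mini.IH)
      ultimately show ?case
        using Suc.IH Suc.prems(2) by (auto simp: less_Suc_eq)
    qed simp
    from step[OF Mini.prems] have
      "eval_code (prod_encode (7, encode_recf f)) (cons_code v (list_encode xs)) 0 \<in> D"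
      "eval_code (encode_recf f) (list_encode (v # xs)) 0 \<in> D"
      by (auto simp: simps)
    then show ?case
      by (intro recf_eval.mini pos Mini.IH)
  qed
qed

lemma recf_eval_iff_derivable:
  "recf_eval p xs v \<longleftrightarrow> derivable (eval_code (encode_recf p) (list_encode xs) v)"
  using recf_eval_imp_derivable derivation_imp_recf_eval unfolding derivable_def by blast

section \<open>Derivability as a search over coded finite sets\<close>

lemma derivation_mono:
  assumes "derivation N D" "N \<le> N'"
  shows "derivation N' D"
  unfolding derivation_def
proof
  fix t assume "t \<in> D"
  then obtain f g l y z n where "f < N" "g < N" "l < N" "y < N" "z < N" "n < N"
    "rule_instance D t f g l y z n"
    using assms(1) unfolding derivation_def by blast
  moreover have "i < N'" if "i < N" for i
    using that assms(2) by simp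
  ultimately show "\<exists>f<N'. \<exists>g<N'. \<exists>l<N'. \<exists>y<N'. \<exists>z<N'. \<exists>n<N'. rule_instance D t f g l y z n"
    by blast
qed

text \<open>Each element \<open>t\<close> contributes \<open>2 ^ t > t\<close> to the code, so
  quantifiers over a coded set are bounded by its code.\<close>

lemma less_set_encode:
  assumes "finite D" "t \<in> D"
  shows "t < set_encode D"
proof -
  have "t < 2 ^ t"
    by simp
  also have "2 ^ t \<le> set_encode D"
    unfolding set_encode_def using assms by (simp add: member_le_sum)
  finally show ?thesis .
qed

text \<open>\<open>w\<close> bounds the code of the derivation, its elements and the variables of its rules at once, so
  that derivability takes a single unbounded quantifier.\<close>

definition coded_derivation :: "nat \<Rightarrow> nat \<Rightarrow> bool" where
  "coded_derivation w d \<longleftrightarrow> (\<forall>u<w. u \<in> set_decode d \<longrightarrow>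
     (\<exists>f<w. \<exists>g<w. \<exists>l<w. \<exists>y<w. \<exists>z<w. \<exists>n<w. rule_instance (set_decode d) u f g l y z n))"

lemma coded_derivation_iff:
  assumes "d < w"
  shows "coded_derivation w d \<longleftrightarrow> derivation w (set_decode d)"
proof -
  have "u < w" if "u \<in> set_decode d" for u
    using less_set_encode[OF finite_set_decode that] assms by simp
  then show ?thesis
    unfolding coded_derivation_def derivation_def by blast
qed

lemma derivable_iff_coded:
  "derivable t \<longleftrightarrow> (\<exists>w. \<exists>d<w. t \<in> set_decode d \<and> coded_derivation w d)"
proof
  assume "derivable t"
  then obtain N D where D: "finite D" "derivation N D" "t \<in> D"
    unfolding derivable_def by blast
  let ?w = "Suc (N + set_encode D)" and ?d = "set_encode D"
  have "derivation ?w D"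
    using D(2) by (rule derivation_mono) simp
  then have "?d < ?w \<and> t \<in> set_decode ?d \<and> coded_derivation ?w ?d"
    using D(1,3) by (simp add: coded_derivation_iff)
  then show "\<exists>w. \<exists>d<w. t \<in> set_decode d \<and> coded_derivation w d"
    by blast
next
  assume "\<exists>w. \<exists>d<w. t \<in> set_decode d \<and> coded_derivation w d"
  then show "derivable t"
    unfolding derivable_def using coded_derivation_iff finite_set_decode by blast
qed

lemma decidable_coded_derivation:
  assumes "recfn k w" "recfn k d"
  shows "decidable k (\<lambda>xs. coded_derivation (w xs) (d xs))"
  unfolding coded_derivation_def rule_instance_def
  by (intro decidable_intros assms)

section \<open>Digit sets\<close>

text \<open>Starting at 1 keeps position 0 out of every block.\<close>

primrec block_start :: "nat \<Rightarrow> nat" where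
  "block_start 0 = 1"
| "block_start (Suc j) = block_start j + 4 ^ block_start j"

text \<open>Program \<open>k\<close> governs the positions in block \<open>2 * k + r\<close>, and it is told the start of the block.
  Position 0 is put into the first set to keep the difference of the two reals in \<open>[0, 1]\<close>.\<close>

definition digit_set :: "nat \<Rightarrow> nat set" where
  "digit_set r = {n. r = 0 \<and> n = 0 \<or> (\<exists>k y. block_start (2 * k + r) \<le> n \<and>
     n < block_start (Suc (2 * k + r)) \<and>
     derivable (eval_code k (list_encode [n, block_start (2 * k + r)]) y))}"

lemma recfn_block_start:
  assumes "recfn k a"
  shows "recfn k (\<lambda>xs. block_start (a xs))"
proof -
  have "rec_nat 1 (\<lambda>_ r. r + 4 ^ r) n = block_start n" for n
    by (induction n) auto
  moreover have "recfn k (\<lambda>xs. rec_nat 1 (\<lambda>_ r. r + 4 ^ r) (a xs))"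
    by (intro recfn_rec_nat recfn_intros assms)
  ultimately show ?thesis by simp
qed

lemma strict_mono_block_start: "strict_mono block_start"
  by (simp add: strict_mono_Suc_iff)

lemma block_start_unique:
  assumes "block_start i \<le> n" "n < block_start (Suc i)" "block_start j \<le> n" "n < block_start (Suc j)"
  shows "i = j"
  using assms strict_mono_less_eq[OF strict_mono_block_start]
  by (metis Suc_leI le_trans linorder_neqE_nat not_less)

lemma block_start_pos: "block_start j > 0"
  by (induction j) auto

text \<open>Doubling turns base 4 positions into binary ones. The search variable \<open>w\<close>
  bounds the coded derivation and the output \<open>y\<close>; the others are bounded by
  \<open>m\<close>, as \<open>k <= block_start (2 * k + r) <= n <= m\<close>.\<close>

lemma computably_enumerable_digit_set: "computably_enumerable ((\<lambda>n. 2 * n) ` digit_set r)"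
proof -
  let ?t = "\<lambda>n k y. eval_code k (list_encode [n, block_start (2 * k + r)]) y"
  define Q where "Q w m d n k y \<longleftrightarrow> m = 2 * n \<and>
    block_start (2 * k + r) \<le> n \<and> n < block_start (Suc (2 * k + r)) \<and>
    ?t n k y \<in> set_decode d \<and> coded_derivation w d" for w m d n k y
  define P where "P w m \<longleftrightarrow> r = 0 \<and> m = 0 \<or>
    (\<exists>d<w. \<exists>n<Suc m. \<exists>k<Suc m. \<exists>y<w. Q w m d n k y)" for w m
  have "computably_enumerable {m. \<exists>w. P w m}"
    unfolding P_def Q_def list_encode.simps
    by (rule computably_enumerable_ex)
      (intro decidable_intros decidable_coded_derivation recfn_block_start)
  moreover have "m \<in> (\<lambda>n. 2 * n) ` digit_set r \<longleftrightarrow> (\<exists>w. P w m)" for m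
  proof
    assume "m \<in> (\<lambda>n. 2 * n) ` digit_set r"
    then obtain n where n: "n \<in> digit_set r" "m = 2 * n"
      by blast
    show "\<exists>w. P w m"
    proof (cases "r = 0 \<and> n = 0")
      case True
      then show ?thesis
        using n(2) by (simp add: P_def)
    next
      case False
      then obtain k y where k: "block_start (2 * k + r) \<le> n" "n < block_start (Suc (2 * k + r))"
        "derivable (?t n k y)"
        using n(1) unfolding digit_set_def by blast
      then obtain w d where wd: "d < w" "?t n k y \<in> set_decode d" "coded_derivation w d"
        unfolding derivable_iff_coded by blast
      have "y \<le> ?t n k y"
        by (meson le_prod_encode_2 le_trans)
      also have "\<dots> < d"
        using less_set_encode[OF finite_set_decode wd(2)] by simp
      finally have "y < w"
        using wd(1) by simp
      moreover have "k < Suc m" "n < Suc m"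
        using strict_mono_imp_increasing[OF strict_mono_block_start, of "2 * k + r"] k(1) n(2)
        by linarith+
      moreover have "Q w m d n k y"
        unfolding Q_def using wd k(1,2) n(2) by blast
      ultimately show ?thesis
        unfolding P_def using wd(1) by blast
    qed
  next
    assume "\<exists>w. P w m"
    then consider "r = 0" "m = 0" | w d n k y where "d < w" "Q w m d n k y"
      unfolding P_def by blast
    then show "m \<in> (\<lambda>n. 2 * n) ` digit_set r"
    proof cases
      case 1
      then show ?thesis
        by (simp add: digit_set_def)
    next
      case 2
      then have "derivable (?t n k y)"
        unfolding derivable_iff_coded Q_def by blast
      with 2(2) show ?thesis
        unfolding Q_def digit_set_def by blast
    qed
  qed
  then have "(\<lambda>n. 2 * n) ` digit_set r = {m. \<exists>w. P w m}"
    by blast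
  ultimately show ?thesis
    by simp
qed

text \<open>The program that computes \<open>t\<close> and then semi-decides \<open>W\<close> has a
  code \<open>k\<close>, and \<open>j = 2 * k + r\<close> is the block it governs. By the parity
  statement, only one of \<open>digit_set 0\<close> and \<open>digit_set 1\<close> can meet this
  block.\<close>

lemma digit_set_reduction:
  assumes "computably_enumerable W" "recfn (Suc (Suc 0)) (\<lambda>ys. t (hd ys) (hd (tl ys)))"
  obtains j where "\<And>n. block_start j \<le> n \<Longrightarrow> n < block_start (Suc j) \<Longrightarrow>
      n \<in> digit_set r \<longleftrightarrow> t n (block_start j) \<in> W"
    and "\<And>n s. block_start j \<le> n \<Longrightarrow> n < block_start (Suc j) \<Longrightarrow> n \<in> digit_set s \<Longrightarrow> even (r + s)"
proof -
  obtain f where f: "\<And>n. n \<in> W \<longleftrightarrow> (\<exists>y. recf_eval f [n] y)"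
    using assms(1) unfolding computably_enumerable_def by auto
  obtain g where "\<And>ys. length ys = Suc (Suc 0) \<Longrightarrow> recf_eval g ys (t (hd ys) (hd (tl ys)))"
    using assms(2) unfolding recfn_def by blast
  from this[of "[n, b]" for n b] have g: "recf_eval g [n, b] (t n b)" for n b
    by simp
  define k where "k = encode_recf (Comp f [g])"
  define j where "j = 2 * k + r"
  have "recf_eval (Comp f [g]) [n, b] y \<longleftrightarrow> recf_eval f [t n b] y" for n b y
  proof
    assume "recf_eval (Comp f [g]) [n, b] y"
    then obtain v where "recf_eval g [n, b] v" "recf_eval f [v] y"
      by (elim recf_eval_CompE) (auto simp: length_Suc_conv)
    then show "recf_eval f [t n b] y"
      using recf_eval_deterministic[OF g] by metis
  next
    assume "recf_eval f [t n b] y"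
    then show "recf_eval (Comp f [g]) [n, b] y"
      by (intro recf_eval.comp[of "[t n b]"]) (auto intro: g)
  qed
  then have k: "(\<exists>y. derivable (eval_code k (list_encode [n, b]) y)) \<longleftrightarrow> t n b \<in> W" for n b
    unfolding k_def recf_eval_iff_derivable[symmetric] f by simp
  \<comment> \<open>Positions in a block are positive, which excludes the special clause for
    position 0.\<close>
  have block: "(\<exists>k'. block_start (2 * k' + s) \<le> n \<and> n < block_start (Suc (2 * k' + s)) \<and>
      (\<exists>y. derivable (eval_code k' (list_encode [n, block_start (2 * k' + s)]) y)))"
    if "block_start j \<le> n" "n \<in> digit_set s" for n s
    using that block_start_pos[of j] unfolding digit_set_def by auto
  show ?thesis
  proof (rule that)
    fix n assume n: "block_start j \<le> n" "n < block_start (Suc j)"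
    show "n \<in> digit_set r \<longleftrightarrow> t n (block_start j) \<in> W"
    proof
      assume "n \<in> digit_set r"
      from block[OF n(1) this] obtain k' where k': "block_start (2 * k' + r) \<le> n"
        "n < block_start (Suc (2 * k' + r))"
        "\<exists>y. derivable (eval_code k' (list_encode [n, block_start (2 * k' + r)]) y)"
        by blast
      have "2 * k' + r = j"
        using block_start_unique[OF k'(1,2) n] .
      moreover from this have "k' = k"
        by (simp add: j_def)
      ultimately show "t n (block_start j) \<in> W"
        using k'(3) k by simp
    next
      assume "t n (block_start j) \<in> W"
      with n show "n \<in> digit_set r"
        unfolding digit_set_def k[symmetric] j_def by blast
    qed
    show "even (r + s)" if "n \<in> digit_set s" for s
    proof -
      from block[OF n(1) that] obtain k' where "block_start (2 * k' + s) \<le> n"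
        "n < block_start (Suc (2 * k' + s))"
        by blast
      from block_start_unique[OF this n] have "2 * k' + s = 2 * k + r"
        by (simp add: j_def)
      then show ?thesis
        by presburger
    qed
  qed
qed

text \<open>Even numbers code the nonnegative integers, so doubling both components is a recursive
  way to write down a code of a nonnegative fraction.\<close>

lemma of_rat_nat_to_rat_surj:
  assumes "q > 0"
  shows "real_of_rat (nat_to_rat_surj (prod_encode (2 * p, 2 * q))) = real p / real q"
proof -
  have "int_decode (2 * n) = int n" for n :: nat
    by (simp add: int_decode_def sum_decode_def)
  then show ?thesis
    using assms by (simp add: nat_to_rat_surj_def of_rat_rat)
qed

section \<open>The analytic argument\<close>

text \<open>The weight of binary position \<open>2 * n\<close>. All later weights together amount to
  \<open>weight n / 3\<close>, less than the \<open>weight n / 2\<close> by which a test point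
  differs from its candidate.\<close>

definition weight :: "nat \<Rightarrow> real" where
  "weight n = 1 / 2 * (1 / 4) ^ n"

lemma weight_pos: "weight n > 0"
  by (simp add: weight_def)

lemma weight_tail_sums: "(\<lambda>m. weight (m + n)) sums (4 / 3 * weight n)"
proof -
  have "(\<lambda>m. (1 / 4) ^ m) sums (4 / 3 :: real)"
    using geometric_sums[of "1 / 4 :: real"] by simp
  from sums_mult[OF this, of "weight n"] show ?thesis
    by (simp add: weight_def power_add mult_ac)
qed

lemma tail_bound:
  fixes \<delta> :: "nat \<Rightarrow> real"
  assumes "\<delta> sums s" "\<And>m. \<bar>\<delta> m\<bar> \<le> weight m"
  shows "\<bar>s - (\<Sum>m<n. \<delta> m)\<bar> \<le> 4 / 3 * weight n"
proof -
  have "(\<lambda>m. \<delta> (m + n)) sums (s - (\<Sum>m<n. \<delta> m))"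
    using assms(1) by (simp add: sums_iff_shift)
  moreover have "norm (\<Sum>m. \<delta> (m + n)) \<le> (\<Sum>m. weight (m + n))"
    by (rule norm_suminf_le) (use assms(2) weight_tail_sums[THEN sums_summable] in simp_all)
  ultimately show ?thesis
    using sums_unique weight_tail_sums by (metis real_norm_def)
qed

text \<open>The candidates \<open>1 - j / 4 ^ b\<close> for the value of the digits before \<open>b\<close> are tried in decreasing
  order. Candidates that are too large lie above \<open>x\<close> and leave no digit, so that the digits before
  position \<open>b + i\<close> of the correct candidate are known; the test made there is then wrong.\<close>

lemma block_contradiction:
  fixes \<delta> :: "nat \<Rightarrow> real"
  assumes \<delta>: "\<delta> sums (x - c)" "\<And>m. \<bar>\<delta> m\<bar> \<le> weight m"
    and prefix: "c + (\<Sum>m<b. \<delta> m) = 1 - real i / 4 ^ b" and "i < 4 ^ b"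
    and block: "\<And>j. j < 4 ^ b \<Longrightarrow> \<delta> (b + j) =
      (if 1 - real j / 4 ^ b - weight (b + j) / 2 < x then - weight (b + j) else 0)"
  shows False
proof -
  have "\<delta> (b + j) = 0" if "j < i" for j
  proof -
    have "weight (b + j) \<le> weight b"
      by (simp add: weight_def power_decreasing)
    moreover have "(real i - real j) / 4 ^ b \<ge> 1 / 4 ^ b"
      using that by (intro divide_right_mono) auto
    moreover have "x \<le> 1 - real i / 4 ^ b + 4 / 3 * weight b"
      using tail_bound[OF \<delta>, of b] prefix by linarith
    moreover have "weight b = 1 / 2 * (1 / 4 ^ b)"
      by (simp add: weight_def power_one_over)
    moreover have "1 / 4 ^ b > (0 :: real)"
      by simp
    \<comment> \<open>In units of \<open>1 / 4 ^ b\<close> above the true prefix, \<open>x\<close>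
      is at most 2/3, while the test point is at least 1 - 1/4.\<close>
    ultimately have "\<not> 1 - real j / 4 ^ b - weight (b + j) / 2 < x"
      unfolding diff_divide_distrib by linarith
    then show ?thesis
      using block[of j] that \<open>i < 4 ^ b\<close> by simp
  qed
  then have "(\<Sum>m<b + j. \<delta> m) = (\<Sum>m<b. \<delta> m)" if "j \<le> i" for j
    using that by (induction j) auto
  then have "c + (\<Sum>m<Suc (b + i). \<delta> m) = 1 - real i / 4 ^ b + \<delta> (b + i)"
    using prefix by simp
  moreover have "weight (Suc (b + i)) = weight (b + i) / 4"
    by (simp add: weight_def)
  ultimately have "\<bar>x - (1 - real i / 4 ^ b + \<delta> (b + i))\<bar> \<le> weight (b + i) / 3"
    using tail_bound[OF \<delta>, of "Suc (b + i)"] by linarith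
  \<comment> \<open>With \<open>q\<close> the candidate and \<open>w = weight (b + i)\<close>: digit
    \<open>-w\<close> forces \<open>x <= q - 2 * w / 3\<close>, and digit 0 forces
    \<open>x >= q - w / 3\<close>. Either is on the wrong side of \<open>q - w / 2\<close>.\<close>
  with block[OF \<open>i < 4 ^ b\<close>] weight_pos[of "b + i"] show False
    by (auto split: if_splits)
qed

text \<open>All weights before \<open>b\<close> are multiples of \<open>1 / 4 ^ b\<close>. The first
  digit contributes 1/2 and the others at most 1/6 in absolute value. Both bounds are strict, so
  that the prefix of \<open>x\<close> and that of \<open>1 - x\<close> are among the
  candidates.\<close>

lemma prefix_numerator:
  fixes \<delta> :: "nat \<Rightarrow> real"
  assumes \<delta>: "\<And>m. \<delta> m \<in> {- weight m, 0, weight m}" and "\<delta> 0 = weight 0" and "b > 0"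
  obtains i where "0 < i" "i < 4 ^ b" "(\<Sum>m<b. \<delta> m) = real i / 4 ^ b"
proof -
  let ?P = "\<Sum>m<b. \<delta> m"
  have "4 ^ b * \<delta> m \<in> \<int>" if "m < b" for m
  proof -
    obtain d where "b = Suc (m + d)"
      using \<open>m < b\<close> less_imp_Suc_add by auto
    then have "4 ^ b * weight m = of_int (2 * 4 ^ d)"
      by (simp add: weight_def power_add power_one_over)
    then have "4 ^ b * weight m \<in> \<int>"
      by (metis Ints_of_int)
    then show ?thesis
      using \<delta>[of m] by auto
  qed
  then have "4 ^ b * ?P \<in> \<int>"
    unfolding sum_distrib_left by (intro Ints_sum) auto
  then obtain z where z: "4 ^ b * ?P = of_int z"
    by (auto elim: Ints_cases)
  have "\<bar>\<Sum>m\<in>{1..<b}. \<delta> m\<bar> \<le> (\<Sum>m\<in>{1..<b}. weight m)"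
  proof (rule order_trans[OF sum_abs sum_mono])
    show "\<bar>\<delta> m\<bar> \<le> weight m" for m
      using \<delta>[of m] weight_pos[of m] by auto
  qed
  moreover have "{..<b} = insert 0 {1..<b}"
    using \<open>b > 0\<close> by auto
  then have "(\<Sum>m<b. h m) = h 0 + (\<Sum>m\<in>{1..<b}. h m)" for h :: "nat \<Rightarrow> real"
    by simp
  moreover have "(\<Sum>m<b. weight m) \<le> 4 / 3 * weight 0"
    using sum_le_suminf[of weight "{..<b}"] weight_tail_sums[of 0] weight_pos
    by (auto simp: sums_iff less_imp_le)
  ultimately have "0 < ?P" "?P < 1"
    using \<open>\<delta> 0 = weight 0\<close> by (simp_all add: weight_def)
  then have "0 < 4 ^ b * ?P" "4 ^ b * ?P < 4 ^ b * 1"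
    by simp_all
  then have "0 < z" "z < 4 ^ b"
    unfolding z by simp_all
  then have "0 < nat z" "nat z < 4 ^ b"
    by (simp_all add: nat_less_iff)
  moreover have "?P = real (nat z) / 4 ^ b"
    using z \<open>0 < z\<close> by (simp add: field_simps)
  ultimately show ?thesis
    using that by blast
qed

lemma summable_weight_indicator: "summable (\<lambda>n. if n \<in> A then weight n else 0)"
proof (rule summable_comparison_test')
  show "summable weight"
    using weight_tail_sums[of 0] by (simp add: sums_iff)
qed (use weight_pos less_imp_le in auto)

text \<open>The binary expansion has the base 4 digits at the even positions and 0 at the odd
  ones.\<close>

lemma strongly_left_ce_doubled:
  assumes "computably_enumerable ((\<lambda>n. 2 * n) ` A)"
  shows "strongly_left_ce (\<Sum>n. if n \<in> A then weight n else 0)"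
proof -
  let ?f = "\<lambda>m. if m \<in> (\<lambda>n. 2 * n) ` A then (1 / 2) ^ (m + 1) else (0 :: real)"
  have "?f (2 * n) = (if n \<in> A then weight n else 0)" for n
    by (auto simp: weight_def power_mult power2_eq_square)
  then have "(\<lambda>n. ?f (2 * n)) sums (\<Sum>n. if n \<in> A then weight n else 0)"
    using summable_weight_indicator[of A] by (simp add: summable_sums)
  then have "?f sums (\<Sum>n. if n \<in> A then weight n else 0)"
    by (subst (asm) sums_mono_reindex) (auto simp: strict_mono_def)
  with assms show ?thesis
    unfolding strongly_left_ce_def by blast
qed

theorem proposition1p3:
  "\<exists>\<alpha> \<beta> :: real. strongly_left_ce \<alpha> \<and> strongly_left_ce \<beta> \<and>
     \<not> left_ce (\<alpha> - \<beta>) \<and> \<not> right_ce (\<alpha> - \<beta>)"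
proof -
  define real_of where "real_of A = (\<Sum>n. if n \<in> A then weight n else 0)" for A
  define x where "x = real_of (digit_set 0) - real_of (digit_set 1)"
  define \<delta> where "\<delta> n = (if n \<in> digit_set 0 then weight n else 0) -
    (if n \<in> digit_set 1 then weight n else 0)" for n
  have \<delta>_sums: "\<delta> sums x"
    unfolding x_def \<delta>_def real_of_def
    by (intro sums_diff summable_sums summable_weight_indicator)
  have \<delta>_range: "\<delta> n \<in> {- weight n, 0, weight n}" for n
    by (simp add: \<delta>_def)
  then have \<delta>_bound: "\<bar>\<delta> n\<bar> \<le> weight n" for n
    using weight_pos[of n] by (smt (verit) insert_iff singletonD)
  have "0 \<notin> digit_set 1"
    using block_start_pos by (auto simp: digit_set_def not_le)
  then have \<delta>_0: "\<delta> 0 = weight 0"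
    by (simp add: \<delta>_def digit_set_def)
  have code: "real_of_rat (nat_to_rat_surj (prod_encode (2 * p, 2 * (4 * 4 ^ (b + j) * 4 ^ b)))) =
      real p / (4 * 4 ^ (b + j) * 4 ^ b)" for p b j :: nat
    by (subst of_rat_nat_to_rat_surj) simp_all
  have "\<not> left_ce x"
  proof
    assume "left_ce x"
    then have W: "computably_enumerable {c. real_of_rat (nat_to_rat_surj c) < x}"
      unfolding left_ce_def computably_enumerable_rat_def by simp
    \<comment> \<open>A code of the test point \<open>1 - j / 4 ^ b - weight n / 2\<close> for
      \<open>j = n - b\<close>, over the common denominator
      \<open>4 * 4 ^ n * 4 ^ b\<close>.\<close>
    define t :: "nat \<Rightarrow> nat \<Rightarrow> nat" where "t n b = prod_encode
      (2 * ((4 ^ b - (n - b)) * (4 * 4 ^ n) - 4 ^ b), 2 * (4 * 4 ^ n * 4 ^ b))" for n b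
    have "recfn (Suc (Suc 0)) (\<lambda>ys. t (hd ys) (hd (tl ys)))"
      unfolding t_def by (intro recfn_intros)
    \<comment> \<open>Membership in \<open>digit_set 1\<close> gives the digit -1, which pushes
      \<open>x\<close> below the test point.\<close>
    from digit_set_reduction[OF W this, of 1] obtain k where
      k: "\<And>n. block_start k \<le> n \<Longrightarrow> n < block_start (Suc k) \<Longrightarrow>
        n \<in> digit_set 1 \<longleftrightarrow> t n (block_start k) \<in> {c. real_of_rat (nat_to_rat_surj c) < x}"
      "\<And>n s. block_start k \<le> n \<Longrightarrow> n < block_start (Suc k) \<Longrightarrow> n \<in> digit_set s \<Longrightarrow> even (1 + s)"
      by metis
    define b where "b = block_start k"
    obtain i where i: "0 < i" "i < 4 ^ b" "(\<Sum>m<b. \<delta> m) = real i / 4 ^ b"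
      using prefix_numerator[OF \<delta>_range \<delta>_0, of b] block_start_pos b_def by metis
    show False
    \<comment> \<open>Candidate number \<open>4 ^ b - i\<close> is \<open>i / 4 ^ b\<close>, the
      true prefix.\<close>
    proof (rule block_contradiction[of \<delta> x 0 b "4 ^ b - i"])
      fix j :: nat assume j: "j < 4 ^ b"
      let ?p = "(4 ^ b - j) * (4 * 4 ^ (b + j)) - 4 ^ b :: nat"
      \<comment> \<open>This makes the truncated subtraction in the numerator exact.\<close>
      have "(4 :: nat) ^ b \<le> 4 ^ (b + j)"
        by (rule power_increasing) auto
      also have "\<dots> \<le> 1 * (4 * 4 ^ (b + j))"
        by simp
      also have "\<dots> \<le> (4 ^ b - j) * (4 * 4 ^ (b + j))"
        using j by (intro mult_right_mono) auto
      finally have "real ?p = (4 ^ b - real j) * (4 * 4 ^ (b + j)) - 4 ^ b"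
        using j by (simp add: of_nat_diff)
      then have "real ?p / (4 * 4 ^ (b + j) * 4 ^ b) = 1 - real j / 4 ^ b - weight (b + j) / 2"
        by (simp add: weight_def power_one_over field_simps)
      then have "real_of_rat (nat_to_rat_surj (t (b + j) b)) =
          1 - real j / 4 ^ b - weight (b + j) / 2"
        by (simp only: t_def code add_diff_cancel_left')
      moreover have "b + j \<notin> digit_set 0"
        using k(2)[of "b + j" 0] j by (auto simp: b_def)
      ultimately show "\<delta> (b + j) =
          (if 1 - real j / 4 ^ b - weight (b + j) / 2 < x then - weight (b + j) else 0)"
        using k(1)[of "b + j"] j by (simp add: \<delta>_def b_def)
    qed (use i \<delta>_sums \<delta>_bound in \<open>simp_all add: of_nat_diff diff_divide_distrib\<close>)
  qed
  moreover have "\<not> right_ce x"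
  proof
    assume "right_ce x"
    then have W: "computably_enumerable {c. real_of_rat (nat_to_rat_surj c) > x}"
      unfolding right_ce_def computably_enumerable_rat_def by simp
    \<comment> \<open>A code of \<open>j / 4 ^ b + weight n / 2\<close>, the image of the earlier
      test point under the reflection \<open>x\<close> to \<open>1 - x\<close>.\<close>
    define t :: "nat \<Rightarrow> nat \<Rightarrow> nat" where "t n b = prod_encode
      (2 * ((n - b) * (4 * 4 ^ n) + 4 ^ b), 2 * (4 * 4 ^ n * 4 ^ b))" for n b
    have "recfn (Suc (Suc 0)) (\<lambda>ys. t (hd ys) (hd (tl ys)))"
      unfolding t_def by (intro recfn_intros)
    from digit_set_reduction[OF W this, of 0] obtain k where
      k: "\<And>n. block_start k \<le> n \<Longrightarrow> n < block_start (Suc k) \<Longrightarrow>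
        n \<in> digit_set 0 \<longleftrightarrow> t n (block_start k) \<in> {c. real_of_rat (nat_to_rat_surj c) > x}"
      "\<And>n s. block_start k \<le> n \<Longrightarrow> n < block_start (Suc k) \<Longrightarrow> n \<in> digit_set s \<Longrightarrow> even (0 + s)"
      by metis
    define b where "b = block_start k"
    obtain i where i: "0 < i" "i < 4 ^ b" "(\<Sum>m<b. \<delta> m) = real i / 4 ^ b"
      using prefix_numerator[OF \<delta>_range \<delta>_0, of b] block_start_pos b_def by metis
    show False
    \<comment> \<open>Reflection negates the digits and adds the offset 1, so the true prefix of
      \<open>1 - x\<close> is \<open>1 - i / 4 ^ b\<close>, candidate number
      \<open>i\<close>.\<close>
    proof (rule block_contradiction[of "\<lambda>n. - \<delta> n" "1 - x" 1 b i])
      fix j :: nat assume j: "j < 4 ^ b"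
      let ?p = "j * (4 * 4 ^ (b + j)) + 4 ^ b :: nat"
      have "real ?p / (4 * 4 ^ (b + j) * 4 ^ b) = real j / 4 ^ b + weight (b + j) / 2"
        by (simp add: weight_def power_one_over field_simps)
      then have "real_of_rat (nat_to_rat_surj (t (b + j) b)) =
          real j / 4 ^ b + weight (b + j) / 2"
        by (simp only: t_def code add_diff_cancel_left')
      moreover have "b + j \<notin> digit_set 1"
        using k(2)[of "b + j" 1] j by (auto simp: b_def)
      ultimately show "- \<delta> (b + j) =
          (if 1 - real j / 4 ^ b - weight (b + j) / 2 < 1 - x then - weight (b + j) else 0)"
        using k(1)[of "b + j"] j by (simp add: \<delta>_def b_def)
    qed (use i \<delta>_sums \<delta>_bound in \<open>simp_all add: sum_negf sums_minus\<close>)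
  qed
  ultimately show ?thesis
    unfolding x_def real_of_def
    using strongly_left_ce_doubled[OF computably_enumerable_digit_set] by blast
qed

end
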